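(* For complex $a,b,m,u,x$, $$\sum_{n=0}^{\infty}\frac{x^n(x+1)^{-n}\,\Gamma(b+m+n+1)\;{}_2F_1(-a,-n;\,b+m+1;\,u)}{\Gamma(n+1)\,\Gamma(b+m+1)}=(ux+1)^a(x+1)^{b+m+1}.$$
   Context: $\Gamma$ is the Euler gamma function and ${}_2F_1(a,b;c;z)=\sum_{k\ge0}\frac{(a)_k(b)_k}{(c)_k\,k!}z^k$ is the Gauss hypergeometric function, with $(a)_k=a(a+1)\cdots(a+k-1)$.
   Formalization: Assumes b+m+1 is not a nonpositive integer, x≠-1, and the series converges (proved if |x/(x+1)|<1 and |(1-u)x/(x+1)|<1 or a∈N). Powers are principal, 0^0=1; if Re x<-1/2 and a is not an integer, the arguments of ux+1 and x+1 must differ by at most π. *)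

theory Defs
  imports "HOL-Analysis.Analysis"
begin

definition hyp2F1 :: "complex \<Rightarrow> complex \<Rightarrow> complex \<Rightarrow> complex \<Rightarrow> complex" where
  "hyp2F1 a b c z =
     (\<Sum>k. pochhammer a k * pochhammer b k / (pochhammer c k * fact k) * z ^ k)"

text \<open>Principal branch, normalised by \<open>z\<^sup>0 = 1\<close> also at \<open>z = 0\<close>; the library has
  \<open>0 powr 0 = 0\<close>.  This matters only if \<open>a = 0\<close> and \<open>u * x + 1 = 0\<close>.\<close>
definition cpow :: "complex \<Rightarrow> complex \<Rightarrow> complex" where
  "cpow z w = (if w = 0 then 1 else z powr w)"

definition summand :: "complex \<Rightarrow> complex \<Rightarrow> complex \<Rightarrow> complex \<Rightarrow> complex \<Rightarrow> nat \<Rightarrow> complex" where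
  "summand a b m u x n =
     x ^ n * (x + 1) powi (- int n) * Gamma (b + m + of_nat n + 1)
       * hyp2F1 (- a) (- of_nat n) (b + m + 1) u
     / (Gamma (of_nat n + 1) * Gamma (b + m + 1))"

text \<open>For \<open>c = b + m + 1\<close> and \<open>z = x / (x + 1)\<close> the series is the Taylor expansion of
  \<open>(1 - z)\<^bsup>- c - a\<^esup> (1 - (1 - u) z)\<^bsup>a\<^esup>\<close>.  It converges if \<open>\<bar>z\<bar> < 1\<close> and either
  \<open>\<bar>(1 - u) z\<bar> < 1\<close> or \<open>a\<close> is a natural number.

  If it converges at a point with \<open>\<bar>z\<bar> \<le> 1\<close>, that is \<open>Re x \<ge> - 1/2\<close>, the principal
  branches of \<open>(u x + 1)\<^bsup>a\<^esup>\<close> and \<open>(x + 1)\<^bsup>c\<^esup>\<close> are the right ones.  Convergence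
  with \<open>\<bar>z\<bar> > 1\<close> is possible only if \<open>- c - a\<close> is a natural number.  Then the product of the
  principal values can differ from the sum by a factor \<open>exp (\<plusminus> 2 \<pi> \<i> a)\<close>;
  it does not if \<open>a\<close> is an integer or if the arguments of \<open>u x + 1\<close> and \<open>x + 1\<close>
  differ by at most \<open>\<pi>\<close>.\<close>
definition branches_agree :: "complex \<Rightarrow> complex \<Rightarrow> complex \<Rightarrow> bool" where
  "branches_agree a u x \<longleftrightarrow>
     Re x \<ge> - 1 / 2 \<or> a \<in> \<int> \<or> \<bar>Arg (u * x + 1) - Arg (x + 1)\<bar> \<le> pi"

end

(* With c = b + m + 1, p = - c - a, w = 1 - u and z = x / (x + 1), Vandermonde's identity turns
   the summand into the n-th term of F(z) = (1 - z)^p (1 - w z)^a.  The power series F satisfies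
     F' (1 - z) (1 - w z) = F (- p (1 - w z) - a w (1 - z)),
   so if 1 or 1/w lies inside the disc of convergence, its order as a zero of F equals p or a
   (- c, excluded, if w = 1), which is then a natural number.  Hence both factors have convergent
   binomial series, with principal values as sums, throughout the open disc of radius |z|.
   Abel's limit theorem identifies the sum at z with the limit of (1 - r z)^p (1 - r w z)^a for
   r -> 1.  If w z = 1, the factor (1 - r)^a has a nonzero limit only for a = 0. *)

theory Submission
  imports Defs "HOL-Complex_Analysis.Conformal_Mappings"
begin

section \<open>Abel's limit theorem along a radius\<close>

text \<open>Summation by parts turns the difference from the sum into \<open>1 - r\<close> times the
  series of \<open>d n * r ^ n\<close>, where \<open>d n\<close> is the error of the n-th partial
  sum. The factor \<open>1 - r\<close> kills every finite head and offsets the growth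
  \<open>1 / (1 - r)\<close> of the tail, whose coefficients are small.\<close>

lemma Abel_limit:
  fixes a :: "nat \<Rightarrow> complex"
  assumes "summable a"
  shows "((\<lambda>r. \<Sum>n. a n * of_real r ^ n) \<longlongrightarrow> (\<Sum>n. a n)) (at_left (1::real))"
proof -
  define s where "s n = (\<Sum>k\<le>n. a k)" for n
  define S where "S = (\<Sum>n. a n)"
  define d where "d n = s n - S" for n
  have "s \<longlonglongrightarrow> S"
    unfolding s_def S_def using summable_LIMSEQ'[OF assms] .
  then have d0: "d \<longlonglongrightarrow> 0"
    unfolding d_def by (simp add: LIM_zero)
  then have "Bseq d"
    by (intro convergent_imp_Bseq convergentI)
  then obtain M where "\<forall>n. norm (d n) \<le> M"
    unfolding Bseq_def by blast
  then have M: "norm (d n) \<le> M" for n ..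
  have M0: "0 \<le> M" using M[of 0] norm_ge_zero order_trans by blast
  have sum_d: "summable (\<lambda>n. norm (d n * of_real r ^ n))" if "0 < r" "r < 1" for r :: real
  proof (rule summable_comparison_test')
    show "summable (\<lambda>n. M * r ^ n)" using that by (intro summable_mult summable_geometric) auto
    show "norm (norm (d n * of_real r ^ n)) \<le> M * r ^ n" if "n \<ge> 0" for n
      using M[of n] \<open>0 < r\<close> by (simp add: norm_mult norm_power mult_right_mono)
  qed
  have eq: "(\<Sum>n. a n * of_real r ^ n) - S = (1 - of_real r) * (\<Sum>n. d n * of_real r ^ n)"
    if r: "0 < r" "r < 1" for r :: real
  proof -
    define D where "D = (\<lambda>n. d n * complex_of_real r ^ n)"
    have D: "summable D"
      unfolding D_def using sum_d[OF r] by (rule summable_norm_cancel)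
    \<comment> \<open>This is \<open>a (Suc n) = d (Suc n) - d n\<close>, multiplied by
      \<open>r ^ Suc n\<close>.\<close>
    have "a (Suc n) * of_real r ^ Suc n = D (Suc n) - of_real r * D n" for n
      by (simp add: D_def d_def s_def algebra_simps)
    moreover have "(\<lambda>n. D (Suc n) - of_real r * D n) sums (suminf D - D 0 - of_real r * suminf D)"
      using D by (intro sums_diff sums_mult) (auto simp: sums_Suc_iff)
    ultimately have "(\<lambda>n. a (Suc n) * of_real r ^ Suc n) sums (suminf D - D 0 - of_real r * suminf D)"
      by simp
    then have "(\<lambda>n. a n * of_real r ^ n) sums (suminf D - D 0 - of_real r * suminf D + a 0)"
      by (subst (asm) sums_Suc_iff) simp
    then have "(\<Sum>n. a n * of_real r ^ n) = suminf D - D 0 - of_real r * suminf D + a 0"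
      by (simp add: sums_iff)
    moreover have "a 0 - D 0 = S" by (simp add: D_def d_def s_def)
    ultimately show ?thesis unfolding D_def[symmetric] by (simp add: algebra_simps)
  qed
  have "((\<lambda>r. (\<Sum>n. a n * of_real r ^ n) - S) \<longlongrightarrow> 0) (at_left 1)"
  proof (rule tendstoI)
    fix \<epsilon> :: real assume "0 < \<epsilon>"
    then obtain N where N: "\<And>n. n \<ge> N \<Longrightarrow> norm (d n) < \<epsilon> / 2"
      using LIMSEQ_D[OF d0, of "\<epsilon>/2"] by auto
    \<comment> \<open>The first \<open>N\<close> terms are bounded by \<open>M\<close> each, the
      others by a geometric series with sum \<open>\<epsilon> / 2 / (1 - r)\<close>.\<close>
    have bound: "norm ((\<Sum>n. a n * of_real r ^ n) - S) \<le> (1 - r) * (N * M) + \<epsilon> / 2"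
      if r: "0 < r" "r < 1" for r :: real
    proof -
      note sm = sum_d[OF r]
      have "norm (\<Sum>n. d n * of_real r ^ n) \<le> (\<Sum>n. norm (d n * of_real r ^ n))"
        using sm by (rule summable_norm)
      also have "\<dots> = (\<Sum>n. norm (d (n + N) * of_real r ^ (n + N))) + (\<Sum>n<N. norm (d n * of_real r ^ n))"
        using sm by (rule suminf_split_initial_segment)
      also have "\<dots> \<le> (\<Sum>n. \<epsilon> / 2 * r ^ n) + (\<Sum>n<N. M)"
      proof (intro add_mono suminf_le sum_mono)
        fix n
        show "norm (d n * of_real r ^ n) \<le> M"
          using mult_mono[OF M[of n] power_le_one[of r n]] r M0 by (simp add: norm_mult norm_power)
        have "norm (d (n + N)) * r ^ (n + N) \<le> \<epsilon> / 2 * r ^ n"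
          using N[of "n + N"] r \<open>0 < \<epsilon>\<close>
          by (intro mult_mono power_decreasing) auto
        then show "norm (d (n + N) * of_real r ^ (n + N)) \<le> \<epsilon> / 2 * r ^ n"
          using r by (simp add: norm_mult norm_power)
      next
        show "summable (\<lambda>n. norm (d (n + N) * of_real r ^ (n + N)))"
          using sm by (rule summable_ignore_initial_segment)
        show "summable (\<lambda>n. \<epsilon> / 2 * r ^ n)"
          using r by (intro summable_mult summable_geometric) auto
      qed
      also have "\<dots> = \<epsilon> / 2 / (1 - r) + N * M"
        using r by (subst suminf_mult) (auto simp: suminf_geometric intro!: summable_geometric)
      finally have "(1 - r) * norm (\<Sum>n. d n * of_real r ^ n) \<le> (1 - r) * (\<epsilon> / 2 / (1 - r) + N * M)"
        using r by (intro mult_left_mono) auto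
      also have "\<dots> = (1 - r) * (N * M) + \<epsilon> / 2"
        using r by (simp add: field_simps)
      finally show ?thesis
        unfolding eq[OF r] norm_mult using r norm_of_real[of "1 - r", where 'a = complex] by simp
    qed
    have "((\<lambda>r. (1 - r) * (N * M) + \<epsilon> / 2) \<longlongrightarrow> (1 - 1) * (N * M) + \<epsilon> / 2) (at_left (1::real))"
      by (intro tendsto_intros)
    then have "eventually (\<lambda>r. (1 - r) * (N * M) + \<epsilon> / 2 < \<epsilon>) (at_left (1::real))"
      by (rule order_tendstoD(2)) (use \<open>0 < \<epsilon>\<close> in auto)
    moreover have "eventually (\<lambda>r. r \<in> {0<..<1}) (at_left (1::real))"
      by (rule eventually_at_leftI[of 0]) auto
    ultimately show "eventually (\<lambda>r. dist ((\<Sum>n. a n * of_real r ^ n) - S) 0 < \<epsilon>) (at_left (1::real))"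
      by eventually_elim (use bound in force)
  qed
  then show ?thesis
    unfolding S_def by (rule LIM_zero_cancel)
qed

section \<open>Exponents at a regular singular point\<close>

text \<open>The exponent \<open>e\<close> is the order of vanishing of \<open>f\<close> at the regular singular point \<open>s\<close>,
  found by comparing leading coefficients.\<close>

lemma regular_singular_exponent_in_Nats:
  fixes f q h :: "complex \<Rightarrow> complex"
  assumes hol: "f holomorphic_on S" and S: "open S" "connected S" "s \<in> S"
    and nz: "t \<in> S" "f t \<noteq> 0"
    and ode: "\<And>\<zeta>. \<zeta> \<in> S \<Longrightarrow> \<zeta> \<noteq> s \<Longrightarrow>
      deriv f \<zeta> * (s - \<zeta>) * q \<zeta> = f \<zeta> * ((s - \<zeta>) * h \<zeta> - e * q \<zeta>)"
    and cont: "isCont q s" "isCont h s" and q: "q s \<noteq> 0"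
  shows "e \<in> \<nat>"
proof -
  \<comment> \<open>Split off from \<open>f\<close> its zero at \<open>s\<close>, with
    \<open>k = 0\<close> if \<open>f s\<close> is nonzero. The point \<open>t\<close> keeps
    \<open>f\<close> from vanishing identically.\<close>
  obtain k g R where R: "0 < R" "ball s R \<subseteq> S" "g holomorphic_on ball s R"
      and f: "\<And>\<zeta>. \<zeta> \<in> ball s R \<Longrightarrow> f \<zeta> = (\<zeta> - s) ^ k * g \<zeta>" and g: "g s \<noteq> 0"
  proof (cases "f s = 0")
    case True
    then have "\<not> f constant_on S"
      using S(3) nz True unfolding constant_on_def by metis
    from holomorphic_factor_zero_nonconstant[OF hol S True this] that
    show ?thesis by (metis centre_in_ball)
  next
    case False
    obtain R where "0 < R" "ball s R \<subseteq> S"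
      using S openE by blast
    then show ?thesis
      using False hol holomorphic_on_subset by (intro that[of R f 0]) auto
  qed
  \<comment> \<open>The differential equation rewritten for \<open>g\<close> and divided by
    \<open>(\<zeta> - s) ^ k\<close>, which is nonzero away from \<open>s\<close>.\<close>
  have *: "(of_nat k * g \<zeta> - (s - \<zeta>) * deriv g \<zeta>) * q \<zeta> = g \<zeta> * (e * q \<zeta> - (s - \<zeta>) * h \<zeta>)"
    if \<zeta>: "\<zeta> \<in> ball s R" "\<zeta> \<noteq> s" for \<zeta>
  proof -
    have "(g has_field_derivative deriv g \<zeta>) (at \<zeta>)"
      using R \<zeta> by (intro holomorphic_derivI) auto
    then have "((\<lambda>\<zeta>. (\<zeta> - s) ^ k * g \<zeta>) has_field_derivative
        of_nat k * (\<zeta> - s) ^ (k - 1) * g \<zeta> + (\<zeta> - s) ^ k * deriv g \<zeta>) (at \<zeta>)"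
      by (auto intro!: derivative_eq_intros)
    then have "(f has_field_derivative
        of_nat k * (\<zeta> - s) ^ (k - 1) * g \<zeta> + (\<zeta> - s) ^ k * deriv g \<zeta>) (at \<zeta>)"
      by (rule has_field_derivative_transform_within_open[where S = "ball s R"]) (use \<zeta> f in auto)
    then have "deriv f \<zeta> = of_nat k * (\<zeta> - s) ^ (k - 1) * g \<zeta> + (\<zeta> - s) ^ k * deriv g \<zeta>"
      by (rule DERIV_imp_deriv)
    then have df: "(s - \<zeta>) * deriv f \<zeta> =
        (s - \<zeta>) * (\<zeta> - s) ^ k * deriv g \<zeta> - (of_nat k * ((\<zeta> - s) * (\<zeta> - s) ^ (k - 1))) * g \<zeta>"
      by (simp only: left_diff_distrib distrib_left right_diff_distrib) (simp add: mult_ac)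
    \<comment> \<open>For \<open>k = 0\<close> the truncated exponent \<open>k - 1\<close> is 0, and
      the factor \<open>of_nat k\<close> makes both sides vanish.\<close>
    have pow: "of_nat k * ((\<zeta> - s) * (\<zeta> - s) ^ (k - 1)) = of_nat k * (\<zeta> - s) ^ k"
      by (cases k) auto
    have "(s - \<zeta>) * deriv f \<zeta> = - ((\<zeta> - s) ^ k) * (of_nat k * g \<zeta> - (s - \<zeta>) * deriv g \<zeta>)"
      unfolding df pow by (simp add: algebra_simps)
    moreover have "(s - \<zeta>) * deriv f \<zeta> * q \<zeta> = (\<zeta> - s) ^ k * g \<zeta> * ((s - \<zeta>) * h \<zeta> - e * q \<zeta>)"
      using ode[of \<zeta>] \<zeta> R f[OF \<zeta>(1)] by (auto simp: mult_ac)
    ultimately have "- ((\<zeta> - s) ^ k) * (of_nat k * g \<zeta> - (s - \<zeta>) * deriv g \<zeta>) * q \<zeta>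
        = (\<zeta> - s) ^ k * g \<zeta> * ((s - \<zeta>) * h \<zeta> - e * q \<zeta>)"
      by simp
    then have "(\<zeta> - s) ^ k * ((of_nat k * g \<zeta> - (s - \<zeta>) * deriv g \<zeta>) * q \<zeta>)
        = (\<zeta> - s) ^ k * (g \<zeta> * (e * q \<zeta> - (s - \<zeta>) * h \<zeta>))"
      by (simp add: algebra_simps)
    then show ?thesis using \<zeta> by simp
  qed
  have isC: "isCont g s" "isCont (deriv g) s"
    using R holomorphic_deriv[OF R(3)]
    by (auto intro!: continuous_on_interior[OF holomorphic_on_imp_continuous_on])
  have ev: "eventually (\<lambda>\<zeta>. \<zeta> \<in> ball s R \<and> \<zeta> \<noteq> s) (at s)"
    using R(1) eventually_at_ball[of R s UNIV] by (auto simp: eventually_at_filter elim: eventually_mono)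
  \<comment> \<open>Letting \<open>\<zeta>\<close> tend to \<open>s\<close> in the last equation
    removes the terms with factor \<open>s - \<zeta>\<close> and leaves
    \<open>k * g s * q s = e * g s * q s\<close>.\<close>
  have "((\<lambda>\<zeta>. (of_nat k * g \<zeta> - (s - \<zeta>) * deriv g \<zeta>) * q \<zeta>)
      \<longlongrightarrow> (of_nat k * g s - (s - s) * deriv g s) * q s) (at s)"
    using isC cont unfolding isCont_def by (intro tendsto_intros)
  moreover have "((\<lambda>\<zeta>. (of_nat k * g \<zeta> - (s - \<zeta>) * deriv g \<zeta>) * q \<zeta>)
      \<longlongrightarrow> g s * (e * q s - (s - s) * h s)) (at s)"
  proof (rule Lim_transform_eventually)
    show "((\<lambda>\<zeta>. g \<zeta> * (e * q \<zeta> - (s - \<zeta>) * h \<zeta>)) \<longlongrightarrow> g s * (e * q s - (s - s) * h s)) (at s)"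
      using isC cont unfolding isCont_def by (intro tendsto_intros)
  qed (use ev * in \<open>auto elim!: eventually_mono\<close>)
  ultimately have "(of_nat k * g s - (s - s) * deriv g s) * q s = g s * (e * q s - (s - s) * h s)"
    using tendsto_unique trivial_limit_at by blast
  then have "e = of_nat k" using g q by simp
  then show ?thesis by simp
qed

section \<open>Binomial series and their products\<close>

text \<open>The expansion of \<open>(1 - w X)\<close> to the power \<open>e\<close>. As a formal
  series it raises no question of convergence or branches until it is evaluated.\<close>

definition binom_fps :: "complex \<Rightarrow> complex \<Rightarrow> complex fps" where
  "binom_fps e w = Abs_fps (\<lambda>n. (e gchoose n) * (- w) ^ n)"

lemma binom_fps_nth: "fps_nth (binom_fps e w) n = (e gchoose n) * (- w) ^ n"
  by (simp add: binom_fps_def)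

text \<open>The logarithmic derivative of a binomial power, cleared of its denominator. On
  coefficients it is the recursion from \<open>e gchoose n\<close> to
  \<open>e gchoose Suc n\<close>.\<close>

lemma binom_fps_deriv:
  "fps_deriv (binom_fps e w) * fps_of_poly [:1, - w:] = binom_fps e w * fps_of_poly [:- (e * w):]"
proof (rule fps_ext)
  fix n
  have "of_nat (Suc n) * (e gchoose Suc n) = (e - of_nat n) * (e gchoose n)"
    using gbinomial_mult_1[of e n] by (simp add: algebra_simps)
  then have *: "of_nat (Suc n) * (e gchoose Suc n) * (- w) ^ Suc n
      = (e - of_nat n) * (e gchoose n) * (- w) ^ Suc n"
    by simp
  have lin: "fps_of_poly [:1, - w:] = 1 + fps_const (- w) * fps_X"
    by (simp add: fps_of_poly_pCons mult.commute)
  have nth: "fps_nth (D * (1 + fps_const v * fps_X)) n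
      = fps_nth D n + v * (if n = 0 then 0 else fps_nth D (n - 1))" for D :: "complex fps" and v
    by (simp add: distrib_left mult.left_commute[of D])
  have "fps_nth (fps_deriv (binom_fps e w) * fps_of_poly [:1, - w:]) n
      = of_nat (Suc n) * (e gchoose Suc n) * (- w) ^ Suc n - w * (of_nat n * (e gchoose n) * (- w) ^ n)"
    unfolding lin nth by (cases n) (simp_all add: binom_fps_nth mult.assoc del: of_nat_Suc)
  also have "\<dots> = (e gchoose n) * (- w) ^ n * - (e * w)"
    unfolding * by (simp add: algebra_simps)
  finally show "fps_nth (fps_deriv (binom_fps e w) * fps_of_poly [:1, - w:]) n
      = fps_nth (binom_fps e w * fps_of_poly [:- (e * w):]) n"
    by (simp add: fps_of_poly_const binom_fps_nth del: fps_const_neg)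
qed

text \<open>The product rule is applied to formal series and evaluated only afterwards. So the
  equation holds in the whole disc of convergence of the product, even where the series of a single
  factor diverges.\<close>

lemma binom_fps_prod_ODE:
  fixes w p a \<zeta> :: complex
  defines "F \<equiv> binom_fps p 1 * binom_fps a w"
  assumes \<zeta>: "norm \<zeta> < fps_conv_radius F"
  shows "deriv (eval_fps F) \<zeta> * ((1 - \<zeta>) * (1 - w * \<zeta>)) =
    eval_fps F \<zeta> * (- p * (1 - w * \<zeta>) - a * w * (1 - \<zeta>))"
proof -
  define U W C E where "U = [:1, - 1 :: complex:]" and "W = [:1, - w:]"
    and "C = [:- p:]" and "E = [:- (a * w):]"
  have 1: "fps_deriv (binom_fps p 1) * fps_of_poly U = binom_fps p 1 * fps_of_poly C"
    using binom_fps_deriv[of p 1] by (simp add: U_def C_def)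
  have 2: "fps_deriv (binom_fps a w) * fps_of_poly W = binom_fps a w * fps_of_poly E"
    unfolding W_def E_def by (rule binom_fps_deriv)
  have "fps_deriv F * fps_of_poly (U * W) =
      (fps_deriv (binom_fps p 1) * fps_of_poly U) * (binom_fps a w * fps_of_poly W)
    + (fps_deriv (binom_fps a w) * fps_of_poly W) * (binom_fps p 1 * fps_of_poly U)"
    by (simp add: F_def fps_of_poly_mult algebra_simps)
  then have *: "fps_deriv F * fps_of_poly (U * W) = F * fps_of_poly (C * W + E * U)"
    unfolding 1 2 by (simp add: F_def fps_of_poly_mult fps_of_poly_add algebra_simps)
  have \<zeta>': "norm \<zeta> < fps_conv_radius (fps_deriv F)"
    using \<zeta> fps_conv_radius_deriv[of F] by (rule less_le_trans)
  have "eval_fps (fps_deriv F * fps_of_poly (U * W)) \<zeta> = deriv (eval_fps F) \<zeta> * poly (U * W) \<zeta>"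
    using \<zeta> \<zeta>' by (subst eval_fps_mult) (simp_all only: eval_fps_deriv eval_fps_of_poly
        fps_conv_radius_fps_of_poly, simp)
  moreover have "eval_fps (F * fps_of_poly (C * W + E * U)) \<zeta> = eval_fps F \<zeta> * poly (C * W + E * U) \<zeta>"
    using \<zeta> by (subst eval_fps_mult) (simp_all only: eval_fps_of_poly
        fps_conv_radius_fps_of_poly, simp)
  ultimately have "deriv (eval_fps F) \<zeta> * poly (U * W) \<zeta> = eval_fps F \<zeta> * poly (C * W + E * U) \<zeta>"
    by (simp only: *)
  moreover have "poly (U * W) \<zeta> = (1 - \<zeta>) * (1 - w * \<zeta>)"
      "poly (C * W + E * U) \<zeta> = - p * (1 - w * \<zeta>) - a * w * (1 - \<zeta>)"
    unfolding poly_mult poly_add by (simp_all add: U_def W_def C_def E_def algebra_simps)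
  ultimately show ?thesis by simp
qed

lemma gbinomial_series_abs_summable:
  fixes a \<zeta> :: complex
  assumes "norm \<zeta> < 1 \<or> a \<in> \<nat>"
  shows "summable (\<lambda>n. norm ((a gchoose n) * (- \<zeta>) ^ n))"
  using assms by (intro abs_summable_in_conv_radius) (auto simp: conv_radius_gchoose)

text \<open>For natural \<open>a\<close> the series is a finite sum and the binomial theorem applies
  at every \<open>\<zeta>\<close>; otherwise the generalised binomial series yields the principal
  value.\<close>

lemma gbinomial_series_suminf:
  fixes a \<zeta> :: complex
  assumes "norm \<zeta> < 1 \<or> a \<in> \<nat>"
  shows "(\<Sum>n. (a gchoose n) * (- \<zeta>) ^ n) = cpow (1 - \<zeta>) a"
proof (cases "a \<in> \<nat>")
  case True
  then obtain m where a: "a = of_nat m" by (auto elim: Nats_cases)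
  have "(\<Sum>n. (a gchoose n) * (- \<zeta>) ^ n) = (\<Sum>n\<le>m. (a gchoose n) * (- \<zeta>) ^ n)"
    by (intro suminf_finite) (auto simp: a simp flip: binomial_gbinomial)
  also have "\<dots> = (- \<zeta> + 1) ^ m"
    by (subst binomial_ring) (simp add: a flip: binomial_gbinomial)
  \<comment> \<open>At \<open>\<zeta> = 1\<close> and \<open>m = 0\<close> both sides are 1 by the
    normalisation of \<open>cpow\<close>.\<close>
  also have "\<dots> = cpow (1 - \<zeta>) a"
    by (cases "1 - \<zeta> = 0") (auto simp: cpow_def a powr_nat power_0_left)
  finally show ?thesis .
next
  case False
  with assms have "norm (- \<zeta>) < 1" by simp
  from gen_binomial_complex[OF this, of a] False show ?thesis
    by (auto simp: cpow_def sums_iff)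
qed

text \<open>Cauchy product of two absolutely convergent series. It yields the convergence claim of
  the theorem, and later the values at the points \<open>r * z\<close> with
  \<open>0 < r < 1\<close>.\<close>

lemma binom_fps_prod_sums:
  fixes p a w \<zeta> :: complex
  assumes "norm \<zeta> < 1 \<or> p \<in> \<nat>" "norm (w * \<zeta>) < 1 \<or> a \<in> \<nat>"
  shows "(\<lambda>n. fps_nth (binom_fps p 1 * binom_fps a w) n * \<zeta> ^ n)
    sums (cpow (1 - \<zeta>) p * cpow (1 - w * \<zeta>) a)"
proof -
  have "(\<lambda>n. \<Sum>i\<le>n. ((p gchoose i) * (- \<zeta>) ^ i) * ((a gchoose (n - i)) * (- (w * \<zeta>)) ^ (n - i)))
    sums (cpow (1 - \<zeta>) p * cpow (1 - w * \<zeta>) a)"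
    using Cauchy_product_sums[OF gbinomial_series_abs_summable[OF assms(1)]
        gbinomial_series_abs_summable[OF assms(2)]]
    by (simp only: gbinomial_series_suminf[OF assms(1)] gbinomial_series_suminf[OF assms(2)])
  moreover have "(\<Sum>i\<le>n. ((p gchoose i) * (- \<zeta>) ^ i) * ((a gchoose (n - i)) * (- (w * \<zeta>)) ^ (n - i)))
      = fps_nth (binom_fps p 1 * binom_fps a w) n * \<zeta> ^ n" for n
    unfolding fps_mult_nth sum_distrib_right atMost_atLeast0
  proof (rule sum.cong[OF refl])
    fix i assume "i \<in> {0..n}"
    then have "\<zeta> ^ n = \<zeta> ^ i * \<zeta> ^ (n - i)" by (simp flip: power_add)
    moreover have "(- \<zeta>) ^ i = (- 1) ^ i * \<zeta> ^ i" "(- (w * \<zeta>)) ^ (n - i) = (- w) ^ (n - i) * \<zeta> ^ (n - i)"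
      by (simp_all flip: power_mult_distrib)
    ultimately show "((p gchoose i) * (- \<zeta>) ^ i) * ((a gchoose (n - i)) * (- (w * \<zeta>)) ^ (n - i))
        = fps_nth (binom_fps p 1) i * fps_nth (binom_fps a w) (n - i) * \<zeta> ^ n"
      by (simp add: binom_fps_nth)
  qed
  ultimately show ?thesis by simp
qed

section \<open>Terminating hypergeometric series and Vandermonde's identity\<close>

text \<open>The factor \<open>pochhammer (- of_nat n) k\<close> vanishes for \<open>k > n\<close>,
  and \<open>c\<close> avoids the zeros of the denominators. The form with \<open>gchoose\<close>
  matches \<open>binom_fps_prod_nth\<close> for \<open>p + a = - c\<close>, power by power of
  \<open>u\<close>.\<close>

lemma hyp2F1_terminating:
  assumes c: "c \<notin> \<int>\<^sub>\<le>\<^sub>0"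
  shows "pochhammer c n / fact n * hyp2F1 (- a) (- of_nat n) c u =
    (\<Sum>k\<le>n. (a gchoose k) * (- 1) ^ (n - k) * (- c - of_nat k gchoose (n - k)) * u ^ k)"
proof -
  have "hyp2F1 (- a) (- of_nat n) c u =
      (\<Sum>k\<le>n. pochhammer (- a) k * pochhammer (- of_nat n) k / (pochhammer c k * fact k) * u ^ k)"
    unfolding hyp2F1_def
    by (intro suminf_finite) (auto simp: pochhammer_of_nat_eq_0_lemma)
  moreover have "pochhammer c n / fact n *
      (pochhammer (- a) k * pochhammer (- of_nat n) k / (pochhammer c k * fact k) * u ^ k)
    = (a gchoose k) * (- 1) ^ (n - k) * (- c - of_nat k gchoose (n - k)) * u ^ k" if k: "k \<le> n" for k
  proof -
    have 1: "pochhammer c n = pochhammer c k * pochhammer (c + of_nat k) (n - k)"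
      using k by (rule pochhammer_product)
    have "c \<noteq> - of_nat j" for j using c by auto
    then have 2: "pochhammer c k \<noteq> 0" by (auto simp: pochhammer_eq_0_iff)
    have "of_nat (n choose k) = (-1) ^ k * pochhammer (- of_nat n :: complex) k / fact k"
      by (simp add: binomial_gbinomial gbinomial_pochhammer)
    then have "fact n / (fact k * fact (n - k)) = (-1) ^ k * pochhammer (- of_nat n :: complex) k / fact k"
      using k by (simp add: binomial_fact)
    then have 3: "pochhammer (- of_nat n :: complex) k = (-1) ^ k * fact n / fact (n - k)"
      by (simp add: field_simps)
    have 4: "- (- c - of_nat k) = c + of_nat k" by simp
    show ?thesis
      unfolding gbinomial_pochhammer 1 3 4 using 2 by (simp add: field_simps)
  qed
  ultimately show ?thesis by (simp add: sum_distrib_left)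
qed

text \<open>Expand the powers of \<open>- (1 - u) = u - 1\<close> in \<open>u\<close>. In the
  coefficient of \<open>u ^ k\<close>, trinomial revision takes \<open>a gchoose k\<close> out of
  the sum and Vandermonde's identity evaluates the rest.\<close>

lemma binom_fps_prod_nth:
  "fps_nth (binom_fps p 1 * binom_fps a (1 - u)) n =
    (\<Sum>k\<le>n. (a gchoose k) * (- 1) ^ (n - k) * (p + a - of_nat k gchoose (n - k)) * u ^ k)"
proof -
  \<comment> \<open>The range is extended from \<open>j\<close> to \<open>n\<close> by vanishing
    terms, so that the double sum runs over a square and can be swapped.\<close>
  have pow: "(u - 1) ^ j = (\<Sum>k\<le>n. of_nat (j choose k) * u ^ k * (- 1) ^ (j - k))" if "j \<le> n" for j
  proof -
    have "(u + - 1) ^ j = (\<Sum>k\<le>j. of_nat (j choose k) * u ^ k * (- 1) ^ (j - k))"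
      by (rule binomial_ring)
    also have "\<dots> = (\<Sum>k\<le>n. of_nat (j choose k) * u ^ k * (- 1) ^ (j - k))"
      using that by (intro sum.mono_neutral_left) auto
    finally show ?thesis by simp
  qed
  have "fps_nth (binom_fps p 1 * binom_fps a (1 - u)) n =
      (\<Sum>j\<le>n. (a gchoose j) * (u - 1) ^ j * ((p gchoose (n - j)) * (- 1) ^ (n - j)))"
    by (subst mult.commute) (simp add: fps_mult_nth binom_fps_nth atMost_atLeast0)
  also have "\<dots> = (\<Sum>j\<le>n. \<Sum>k\<le>n. (a gchoose j) * (of_nat (j choose k) * u ^ k * (- 1) ^ (j - k))
      * ((p gchoose (n - j)) * (- 1) ^ (n - j)))"
    by (intro sum.cong refl, subst pow) (auto simp: sum_distrib_left sum_distrib_right)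
  also have "\<dots> = (\<Sum>k\<le>n. \<Sum>j\<le>n. (a gchoose j) * (of_nat (j choose k) * u ^ k * (- 1) ^ (j - k))
      * ((p gchoose (n - j)) * (- 1) ^ (n - j)))"
    by (rule sum.swap)
  also have "\<dots> = (\<Sum>k\<le>n. (a gchoose k) * (- 1) ^ (n - k) * (p + a - of_nat k gchoose (n - k)) * u ^ k)"
  proof (rule sum.cong[OF refl])
    fix k assume "k \<in> {..n}"
    then have k: "k \<le> n" by simp
    \<comment> \<open>The terms with \<open>j < k\<close> vanish; the bounds are written for the
      shift \<open>j = l + k\<close>.\<close>
    have "(\<Sum>j\<le>n. (a gchoose j) * (of_nat (j choose k) * u ^ k * (- 1) ^ (j - k))
          * ((p gchoose (n - j)) * (- 1) ^ (n - j)))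
        = (\<Sum>j=0+k..(n-k)+k. (a gchoose j) * (of_nat (j choose k) * u ^ k * (- 1) ^ (j - k))
          * ((p gchoose (n - j)) * (- 1) ^ (n - j)))"
      using k by (intro sum.mono_neutral_right) auto
    also have "\<dots> = (\<Sum>l=0..n-k. (a gchoose (l + k)) * (of_nat (l + k choose k) * u ^ k * (- 1) ^ l)
          * ((p gchoose (n - (l + k))) * (- 1) ^ (n - (l + k))))"
      by (subst sum.shift_bounds_cl_nat_ivl) simp
    also have "\<dots> = (\<Sum>l=0..n-k. (a gchoose k) * (- 1) ^ (n - k) * u ^ k *
        ((a - of_nat k gchoose l) * (p gchoose (n - k - l))))"
    proof (rule sum.cong[OF refl])
      fix l assume l: "l \<in> {0..n-k}"
      have 1: "(a gchoose (l + k)) * of_nat (l + k choose k) = (a gchoose k) * (a - of_nat k gchoose l)"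
        using gbinomial_trinomial_revision[of k "l + k" a] by (simp add: binomial_gbinomial)
      have 2: "(- 1 :: complex) ^ (n - k) = (- 1) ^ l * (- 1) ^ (n - (l + k))"
        using l k by (simp flip: power_add)
      have 3: "n - k - l = n - (l + k)" by simp
      have "(a gchoose (l + k)) * (of_nat (l + k choose k) * u ^ k * (- 1) ^ l)
          * ((p gchoose (n - (l + k))) * (- 1) ^ (n - (l + k)))
        = ((a gchoose (l + k)) * of_nat (l + k choose k)) * u ^ k * ((- 1) ^ l * (- 1) ^ (n - (l + k)))
          * (p gchoose (n - (l + k)))"
        by (simp only: mult_ac)
      then show "(a gchoose (l + k)) * (of_nat (l + k choose k) * u ^ k * (- 1) ^ l)
          * ((p gchoose (n - (l + k))) * (- 1) ^ (n - (l + k)))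
        = (a gchoose k) * (- 1) ^ (n - k) * u ^ k * ((a - of_nat k gchoose l) * (p gchoose (n - k - l)))"
        unfolding 1 2[symmetric] 3 by (simp only: mult_ac)
    qed
    also have "\<dots> = (a gchoose k) * (- 1) ^ (n - k) * u ^ k * (a - of_nat k + p gchoose (n - k))"
      by (simp only: gbinomial_Vandermonde flip: sum_distrib_left)
    finally show "(\<Sum>j\<le>n. (a gchoose j) * (of_nat (j choose k) * u ^ k * (- 1) ^ (j - k))
          * ((p gchoose (n - j)) * (- 1) ^ (n - j)))
        = (a gchoose k) * (- 1) ^ (n - k) * (p + a - of_nat k gchoose (n - k)) * u ^ k"
      by (simp add: algebra_simps)
  qed
  finally show ?thesis .
qed

text \<open>The Gamma quotient is \<open>pochhammer (b + m + 1) n / fact n\<close>. The choice of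
  the first exponent makes \<open>p + a = - (b + m + 1)\<close>, so the two expansions in
  \<open>u\<close> coincide.\<close>

lemma summand_eq_binom_fps_prod:
  assumes c: "b + m + 1 \<notin> \<int>\<^sub>\<le>\<^sub>0" and x: "x \<noteq> - 1"
  shows "summand a b m u x n =
    fps_nth (binom_fps (- (b + m + 1) - a) 1 * binom_fps a (1 - u)) n * (x / (x + 1)) ^ n"
proof -
  have "x + 1 \<noteq> 0" using x by (simp add: eq_neg_iff_add_eq_0)
  then have 1: "x ^ n * (x + 1) powi (- int n) = (x / (x + 1)) ^ n"
    by (simp add: power_int_minus power_divide divide_inverse power_mult_distrib power_inverse)
  have 2: "Gamma (b + m + of_nat n + 1) / Gamma (b + m + 1) = pochhammer (b + m + 1) n"
    using pochhammer_Gamma[OF c, of n] by (simp add: add_ac)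
  have 3: "Gamma (of_nat n + 1 :: complex) = fact n"
    using Gamma_fact[of n, where 'a = complex] by (simp add: add.commute)
  have "summand a b m u x n = (x ^ n * (x + 1) powi (- int n)) *
      (Gamma (b + m + of_nat n + 1) / Gamma (b + m + 1) / Gamma (of_nat n + 1)
        * hyp2F1 (- a) (- of_nat n) (b + m + 1) u)"
    unfolding summand_def by (simp add: mult_ac)
  also have "\<dots> = (x / (x + 1)) ^ n *
      (pochhammer (b + m + 1) n / fact n * hyp2F1 (- a) (- of_nat n) (b + m + 1) u)"
    unfolding 1 2 3 ..
  finally show ?thesis
    unfolding hyp2F1_terminating[OF c] binom_fps_prod_nth by simp
qed

section \<open>Limits of principal powers\<close>

text \<open>Meant for \<open>w * z = 1\<close>, where the second factor reaches its branch point and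
  continuity gives no limit. For nonzero \<open>a\<close> the limit, if it exists, is 0, because it
  is invariant under a factor \<open>s powr a\<close> other than 1.\<close>

lemma cpow_one_minus_limit_unique:
  assumes lim: "((\<lambda>r. cpow (1 - of_real r) a) \<longlongrightarrow> L) (at_left (1::real))"
  shows "L = cpow 0 a"
proof (cases "a = 0 \<or> L = 0")
  case True
  then show ?thesis
  proof
    assume "a = 0"
    then have "((\<lambda>r. 1) \<longlongrightarrow> L) (at_left (1::real))"
      using lim by (simp add: cpow_def)
    with \<open>a = 0\<close> show ?thesis
      by (simp add: cpow_def tendsto_const_iff)
  next
    assume "L = 0"
    moreover have "a \<noteq> 0"
    proof
      assume "a = 0"
      then have "((\<lambda>r. 1) \<longlongrightarrow> (0::complex)) (at_left (1::real))"
        using lim \<open>L = 0\<close> by (simp add: cpow_def)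
      then show False by (simp add: tendsto_const_iff)
    qed
    ultimately show ?thesis by (simp add: cpow_def)
  qed
next
  case False
  then have a: "a \<noteq> 0" and L: "L \<noteq> 0" by auto
  \<comment> \<open>This choice makes \<open>\<tau> * a\<close> a number of modulus 1.\<close>
  define \<tau> where "\<tau> = 1 / norm a"
  have \<tau>: "\<tau> > 0" using a by (simp add: \<tau>_def)
  define s where "s = exp (- \<tau>)"
  have s: "0 < s" "s < 1" using \<tau> by (auto simp: s_def)
  have lim': "((\<lambda>r. cpow (1 - of_real (1 - s * (1 - r))) a) \<longlongrightarrow> L) (at_left (1::real))"
  proof (rule filterlim_compose[OF lim])
    have "((\<lambda>r. 1 - s * (1 - r)) \<longlongrightarrow> 1 - s * (1 - 1)) (at_left (1::real))"
      by (intro tendsto_intros)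
    moreover have "eventually (\<lambda>r. 1 - s * (1 - r) \<in> {..<1} \<and> 1 - s * (1 - r) \<noteq> 1) (at_left (1::real))"
      using s by (intro eventually_at_leftI[of 0]) auto
    ultimately show "filterlim (\<lambda>r. 1 - s * (1 - r)) (at_left 1) (at_left (1::real))"
      by (simp add: filterlim_at)
  qed
  \<comment> \<open>Rescaling \<open>1 - r\<close> by \<open>s\<close> multiplies the limit by \<open>s\<^sup>a \<noteq> 1\<close>, as \<open>0 < \<bar>\<tau> a\<bar> < 2 \<pi>\<close>.\<close>
  have "eventually (\<lambda>r. cpow (1 - of_real (1 - s * (1 - r))) a
      = exp (- (of_real \<tau> * a)) * cpow (1 - of_real r) a) (at_left (1::real))"
  proof (rule eventually_at_leftI[of 0])
    fix r :: real assume r: "r \<in> {0<..<1}"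
    have "cpow (1 - of_real (1 - s * (1 - r))) a = (of_real s * of_real (1 - r)) powr a"
      using a by (simp add: cpow_def)
    also have "\<dots> = of_real s powr a * of_real (1 - r) powr a"
      using s r by (intro powr_times_real) auto
    also have "of_real s powr a = exp (- (of_real \<tau> * a))"
      using s by (simp add: powr_def s_def Ln_of_real algebra_simps)
    finally show "cpow (1 - of_real (1 - s * (1 - r))) a
        = exp (- (of_real \<tau> * a)) * cpow (1 - of_real r) a"
      using a by (simp add: cpow_def)
  qed auto
  from Lim_transform_eventually[OF lim' this]
  have "((\<lambda>r. exp (- (of_real \<tau> * a)) * cpow (1 - of_real r) a) \<longlongrightarrow> L) (at_left (1::real))" .
  moreover have "((\<lambda>r. exp (- (of_real \<tau> * a)) * cpow (1 - of_real r) a)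
      \<longlongrightarrow> exp (- (of_real \<tau> * a)) * L) (at_left (1::real))"
    by (intro tendsto_intros lim)
  ultimately have "L = exp (- (of_real \<tau> * a)) * L"
    by (intro tendsto_unique[of "at_left (1::real)"]) auto
  then have "exp (- (of_real \<tau> * a)) = 1" using L by simp
  \<comment> \<open>A multiple of \<open>2 * pi * \<i>\<close> has modulus 0 or at least
    \<open>2 * pi\<close>, but the modulus here is 1.\<close>
  then obtain n :: int where re: "Re (- (of_real \<tau> * a)) = 0" and im: "Im (- (of_real \<tau> * a)) = of_int (2 * n) * pi"
    by (auto simp: exp_eq_1)
  have "norm (- (of_real \<tau> * a)) = 1"
    using a by (simp add: norm_mult norm_divide \<tau>_def)
  then have 1: "\<bar>of_int (2 * n) * pi\<bar> = 1"
    using re im by (metis cmod_eq_Im)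
  have "n \<noteq> 0" using 1 by auto
  then have "\<bar>real_of_int (2 * n)\<bar> \<ge> 1" by linarith
  then have "\<bar>real_of_int (2 * n)\<bar> * pi \<ge> 1 * pi" by (intro mult_right_mono) auto
  moreover have "\<bar>real_of_int (2 * n)\<bar> * pi = 1" using 1 by (simp add: abs_mult)
  ultimately have False using pi_gt3 by linarith
  then show ?thesis ..
qed

lemma cpow_eq_powr: "z \<noteq> 0 \<Longrightarrow> cpow z w = z powr w"
  by (simp add: cpow_def)

text \<open>In the closed unit disc, \<open>1 - z\<close> meets the branch cut only at
  \<open>z = 1\<close>; a natural exponent gives a polynomial in \<open>r\<close>.\<close>

lemma tendsto_cpow_left:
  assumes z: "z \<noteq> 1" and "norm z \<le> 1 \<or> e \<in> \<nat>"
  shows "((\<lambda>r. cpow (1 - of_real r * z) e) \<longlongrightarrow> cpow (1 - z) e) (at_left (1::real))"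
proof (cases "e \<in> \<nat>")
  case True
  then obtain k where k: "e = of_nat k" by (auto elim: Nats_cases)
  have pow: "cpow y e = y ^ k" for y
    by (cases "y = 0") (auto simp: cpow_def k powr_nat power_0_left)
  have "((\<lambda>r. (1 - of_real r * z) ^ k) \<longlongrightarrow> (1 - of_real 1 * z) ^ k) (at_left (1::real))"
    by (intro tendsto_intros)
  then show ?thesis by (simp add: pow)
next
  case False
  then have "norm z \<le> 1" using assms by simp
  have "1 - z \<notin> \<real>\<^sub>\<le>\<^sub>0"
  proof
    assume "1 - z \<in> \<real>\<^sub>\<le>\<^sub>0"
    then have "Im z = 0" "Re z \<ge> 1" by (auto simp: complex_nonpos_Reals_iff)
    moreover have "Re z \<le> 1" using \<open>norm z \<le> 1\<close> complex_Re_le_cmod order_trans by blast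
    ultimately show False using z by (simp add: complex_eq_iff)
  qed
  then have "((\<lambda>r. (1 - of_real r * z) powr e) \<longlongrightarrow> (1 - of_real 1 * z) powr e) (at_left (1::real))"
    by (intro tendsto_intros) auto
  moreover have "e \<noteq> 0" using False by auto
  ultimately show ?thesis by (simp add: cpow_def)
qed

section \<open>The substitution \<open>z = x / (x + 1)\<close> and its branches\<close>

text \<open>This compares the distances of \<open>x\<close> from 0 and from -1, whose perpendicular
  bisector is the line \<open>Re x = - 1 / 2\<close>.\<close>

lemma norm_div_add_1_le_iff:
  assumes "x \<noteq> - 1"
  shows "norm (x / (x + 1)) \<le> 1 \<longleftrightarrow> Re x \<ge> - 1 / 2"
proof -
  have "x + 1 \<noteq> 0" using assms by (simp add: eq_neg_iff_add_eq_0)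
  then have "norm (x / (x + 1)) \<le> 1 \<longleftrightarrow> norm x ^ 2 \<le> norm (x + 1) ^ 2"
    by (subst power_mono_iff) (simp_all add: norm_divide divide_le_eq)
  also have "\<dots> \<longleftrightarrow> Re x \<ge> - 1 / 2"
    unfolding cmod_power2 by (auto simp: power2_eq_square algebra_simps)
  finally show ?thesis .
qed

text \<open>For non-integral \<open>a\<close> the point is that
  \<open>Ln (v / y) + Ln y = Ln v\<close> without a multiple of \<open>2 * pi * \<i>\<close>. If
  \<open>Re y > 0\<close>, the two arguments on the left add up to less than \<open>pi\<close> in
  modulus; otherwise the bound on \<open>Arg v - Arg y\<close> decides.\<close>

lemma powr_divide_mult:
  fixes v y a :: complex
  assumes "v \<noteq> 0" "y \<noteq> 0"
    and "a \<in> \<int> \<or> (Re (v / y) \<ge> 0 \<and> (Re y > 0 \<or> \<bar>Arg v - Arg y\<bar> \<le> pi))"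
  shows "(v / y) powr a * y powr a = v powr a"
proof (cases "a \<in> \<int>")
  case True
  then obtain k where "a = of_int k" by (auto elim: Ints_cases)
  then show ?thesis
    using assms by (simp add: complex_powr_of_int flip: power_int_mult_distrib)
next
  case False
  with assms have re: "Re (v / y) \<ge> 0" and arg: "Re y > 0 \<or> \<bar>Arg v - Arg y\<bar> \<le> pi" by auto
  have nz: "v / y \<noteq> 0" using assms by simp
  have "Ln (v / y) + Ln y = Ln v"
    using arg
  proof
    assume "Re y > 0"
    then have "\<bar>Im (Ln y)\<bar> < pi / 2" using assms Re_Ln_pos_lt by blast
    moreover have "\<bar>Im (Ln (v / y))\<bar> \<le> pi / 2" using nz re Re_Ln_pos_le by blast
    ultimately have "Ln (v / y * y) = Ln (v / y) + Ln y"
      using nz assms by (intro Ln_times_simple) auto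
    then show ?thesis using assms by simp
  next
    assume A: "\<bar>Arg v - Arg y\<bar> \<le> pi"
    define M where "M = Ln v - Ln y"
    have expM: "exp M = v / y" using assms by (simp add: M_def exp_diff)
    have "Im M = Arg v - Arg y" using assms by (simp add: M_def Arg_eq_Im_Ln)
    then have im: "\<bar>Im M\<bar> \<le> pi" using A by simp
    \<comment> \<open>\<open>Ln (exp M) = M\<close> holds on the half-open strip from
      \<open>- pi\<close> (excluded) to \<open>pi\<close>. On the excluded edge \<open>v / y\<close>
      would be a negative real.\<close>
    have "Im M \<noteq> - pi"
    proof
      assume "Im M = - pi"
      then have "Re (exp M) < 0" by (simp add: Re_exp)
      then show False using re expM by simp
    qed
    then have "Ln (exp M) = M" using im by (intro Ln_exp) auto
    then show ?thesis unfolding expM by (simp add: M_def)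
  qed
  then show ?thesis
    using assms by (simp add: powr_def flip: exp_add distrib_left)
qed

text \<open>Here \<open>1 - z\<close> is \<open>1 / (x + 1)\<close> and
  \<open>1 - (1 - u) * z\<close> is \<open>(u * x + 1) / (x + 1)\<close>, so the powers of
  \<open>x + 1\<close> collect to the exponent \<open>(c + a) - a = c\<close>. The work lies in
  justifying this for principal values.\<close>

lemma cpow_mobius:
  fixes a c u x :: complex
  defines "z \<equiv> x / (x + 1)"
  assumes x: "x \<noteq> - 1" and c: "c \<noteq> 0"
    and p: "norm z \<le> 1 \<or> - c - a \<in> \<nat>"
    and w: "norm ((1 - u) * z) \<le> 1 \<or> a \<in> \<nat>"
    and br: "branches_agree a u x"
  shows "cpow (1 - z) (- c - a) * cpow (1 - (1 - u) * z) a = cpow (u * x + 1) a * cpow (x + 1) c"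
proof -
  have y: "x + 1 \<noteq> 0" using x by (simp add: eq_neg_iff_add_eq_0)
  have z1: "1 - z = inverse (x + 1)" and z2: "1 - (1 - u) * z = (u * x + 1) / (x + 1)"
    using y by (simp_all add: z_def field_simps)
  have zx: "norm z \<le> 1 \<longleftrightarrow> Re x \<ge> - 1 / 2"
    unfolding z_def using x by (rule norm_div_add_1_le_iff)
  \<comment> \<open>An integral exponent has no branches. If \<open>norm z \<le> 1\<close>, then
    \<open>Re (x + 1) > 0\<close> keeps \<open>x + 1\<close> off the cut, where \<open>Ln\<close>
    turns inversion into negation.\<close>
  have 1: "cpow (1 - z) (- c - a) = (x + 1) powr (c + a)"
    using p
  proof
    assume "- c - a \<in> \<nat>"
    then obtain k where k: "- c - a = of_nat k" by (auto elim: Nats_cases)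
    then have "c + a = - of_nat k" by (metis minus_diff_eq minus_minus diff_minus_eq_add add.commute)
    then show ?thesis
      unfolding z1 k using y by (simp add: cpow_eq_powr powr_nat' powr_minus power_inverse)
  next
    assume "norm z \<le> 1"
    then have "Re (x + 1) > 0" using zx by simp
    then have "x + 1 \<notin> \<real>\<^sub>\<le>\<^sub>0" by (auto simp: complex_nonpos_Reals_iff)
    then have "Ln (inverse (x + 1)) = - Ln (x + 1)" by (rule Ln_inverse)
    then show ?thesis
      unfolding z1 using y by (simp add: cpow_eq_powr powr_def algebra_simps)
  qed
  have 2: "cpow (1 - (1 - u) * z) a * (x + 1) powr a = cpow (u * x + 1) a"
  proof (cases "a = 0 \<or> u * x + 1 = 0")
    case True
    then show ?thesis using y unfolding z2 by (auto simp: cpow_def)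
  next
    case False
    \<comment> \<open>If \<open>a\<close> is not an integer, \<open>w\<close> bounds
      \<open>(1 - u) * z\<close>, which puts the quotient into the closed right half-plane. The
      remaining alternative comes from \<open>branches_agree\<close>.\<close>
    have "a \<in> \<int> \<or> (Re ((u * x + 1) / (x + 1)) \<ge> 0 \<and> (Re (x + 1) > 0 \<or> \<bar>Arg (u * x + 1) - Arg (x + 1)\<bar> \<le> pi))"
    proof (cases "a \<in> \<int>")
      case False
      then have "a \<notin> \<nat>" using Nats_subset_Ints by blast
      then have "norm ((1 - u) * z) \<le> 1" using w by simp
      then have "Re ((1 - u) * z) \<le> 1" using complex_Re_le_cmod order_trans by blast
      then have "Re ((u * x + 1) / (x + 1)) \<ge> 0" by (simp flip: z2)
      moreover have "Re (x + 1) > 0 \<or> \<bar>Arg (u * x + 1) - Arg (x + 1)\<bar> \<le> pi"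
        using br False by (auto simp: branches_agree_def)
      ultimately show ?thesis by blast
    qed auto
    from powr_divide_mult[OF _ y this] False show ?thesis
      unfolding z2 using y by (simp add: cpow_eq_powr)
  qed
  have "cpow (1 - z) (- c - a) * cpow (1 - (1 - u) * z) a
      = (cpow (1 - (1 - u) * z) a * (x + 1) powr a) * (x + 1) powr c"
    unfolding 1 by (simp add: powr_add)
  also have "\<dots> = cpow (u * x + 1) a * cpow (x + 1) c"
    unfolding 2 using y by (simp add: cpow_eq_powr)
  finally show ?thesis .
qed

lemma cpow_nonzero: "z \<noteq> 0 \<Longrightarrow> cpow z w \<noteq> 0"
  by (simp add: cpow_def)

section \<open>Consequences of convergence, and the value of the sum\<close>

text \<open>Convergence at \<open>z\<close> makes the product holomorphic in the open disc of radius
  \<open>norm z\<close>. A singular point 1 or \<open>1 / w\<close> of the differential equation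
  inside that disc must then have a natural exponent.\<close>

lemma binom_fps_prod_summable_imp:
  fixes p a w z :: complex
  assumes sm: "summable (\<lambda>n. fps_nth (binom_fps p 1 * binom_fps a w) n * z ^ n)"
    and pa: "p + a \<notin> \<nat>"
  shows "norm z \<le> 1 \<or> p \<in> \<nat>" and "norm (w * z) \<le> 1 \<or> a \<in> \<nat>"
proof -
  define F where "F = binom_fps p 1 * binom_fps a w"
  define f where "f = eval_fps F"
  define S where "S = ball (0::complex) (norm z)"
  have rad: "norm z \<le> fps_conv_radius F"
    unfolding fps_conv_radius_def F_def by (rule conv_radius_geI) (rule sm)
  have rad': "norm \<zeta> < fps_conv_radius F" if "\<zeta> \<in> S" for \<zeta>
    using that by (intro less_le_trans[OF _ rad]) (simp add: S_def)
  have hol: "f holomorphic_on S"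
    unfolding f_def by (intro holomorphic_on_eval_fps) (use rad' in auto)
  have S: "open S" "connected S" by (auto simp: S_def)
  \<comment> \<open>The constant term of \<open>F\<close> is 1, so \<open>f\<close> is not
    identically zero.\<close>
  have f0: "f 0 \<noteq> 0" by (simp add: f_def F_def eval_fps_at_0 binom_fps_nth)
  have ode: "deriv f \<zeta> * ((1 - \<zeta>) * (1 - w * \<zeta>)) = f \<zeta> * (- p * (1 - w * \<zeta>) - a * w * (1 - \<zeta>))"
    if "\<zeta> \<in> S" for \<zeta>
    using binom_fps_prod_ODE[of \<zeta> p a w] rad'[OF that] by (simp add: f_def F_def)
  have exponent: "e \<in> \<nat>"
    if "s \<in> S" "isCont q s" "isCont h s" "q s \<noteq> 0"
      "\<And>\<zeta>. \<zeta> \<in> S \<Longrightarrow> \<zeta> \<noteq> s \<Longrightarrow> deriv f \<zeta> * (s - \<zeta>) * q \<zeta> = f \<zeta> * ((s - \<zeta>) * h \<zeta> - e * q \<zeta>)"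
    for s q h e
  proof -
    have "0 \<in> S" using that(1) by (auto simp: S_def intro: le_less_trans[OF norm_ge_zero])
    then show ?thesis
      using regular_singular_exponent_in_Nats[OF hol S that(1) _ f0 that(5,2,3,4)] by blast
  qed
  \<comment> \<open>For \<open>w = 1\<close> the two singular points merge into one with exponent
    \<open>p + a\<close>, which \<open>pa\<close> excludes. One factor \<open>1 - \<zeta>\<close> of
    the equation has to be cancelled first.\<close>
  have w1: "w \<noteq> 1" if "norm z > 1"
  proof
    assume "w = 1"
    have "p + a \<in> \<nat>"
    proof (rule exponent[where s = 1 and q = "\<lambda>_. 1" and h = "\<lambda>_. 0"])
      fix \<zeta> assume \<zeta>: "\<zeta> \<in> S" "\<zeta> \<noteq> 1"
      have "(deriv f \<zeta> * (1 - \<zeta>)) * (1 - \<zeta>) = (- f \<zeta> * (p + a)) * (1 - \<zeta>)"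
        using ode[OF \<zeta>(1)] by (simp add: \<open>w = 1\<close> algebra_simps)
      then have "deriv f \<zeta> * (1 - \<zeta>) = - f \<zeta> * (p + a)"
        using \<zeta> by (subst (asm) mult_right_cancel) auto
      then show "deriv f \<zeta> * (1 - \<zeta>) * 1 = f \<zeta> * ((1 - \<zeta>) * 0 - (p + a) * 1)"
        by (simp add: algebra_simps)
    qed (use that in \<open>auto simp: S_def\<close>)
    then show False using pa by simp
  qed
  show "norm z \<le> 1 \<or> p \<in> \<nat>"
  proof (rule disj_imp[THEN iffD2], rule impI)
    assume "\<not> norm z \<le> 1"
    then have z: "norm z > 1" by simp
    \<comment> \<open>At the singular point 1 the cofactor \<open>q\<close> takes the value
      \<open>1 - w\<close>, nonzero by \<open>w1\<close>.\<close>
    show "p \<in> \<nat>"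
    proof (rule exponent[where s = 1 and q = "\<lambda>\<zeta>. 1 - w * \<zeta>" and h = "\<lambda>_. - (a * w)"])
      fix \<zeta> assume \<zeta>: "\<zeta> \<in> S"
      have "- p * (1 - w * \<zeta>) - a * w * (1 - \<zeta>) = (1 - \<zeta>) * - (a * w) - p * (1 - w * \<zeta>)" by simp
      then show "deriv f \<zeta> * (1 - \<zeta>) * (1 - w * \<zeta>) = f \<zeta> * ((1 - \<zeta>) * - (a * w) - p * (1 - w * \<zeta>))"
        using ode[OF \<zeta>] by (simp only: mult.assoc)
    qed (use z w1 in \<open>auto simp: S_def\<close>)
  qed
  show "norm (w * z) \<le> 1 \<or> a \<in> \<nat>"
  proof (rule disj_imp[THEN iffD2], rule impI)
    assume "\<not> norm (w * z) \<le> 1"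
    then have wz: "norm w * norm z > 1" by (simp add: norm_mult)
    then have w: "w \<noteq> 0" by auto
    have "w \<noteq> 1" using wz w1 by auto
    \<comment> \<open>Dividing the equation by \<open>w\<close> produces the factor
      \<open>1 / w - \<zeta>\<close>; the cofactor \<open>1 - \<zeta>\<close> is nonzero at
      \<open>1 / w\<close> because \<open>w \<noteq> 1\<close>.\<close>
    show "a \<in> \<nat>"
    proof (rule exponent[where s = "1 / w" and q = "\<lambda>\<zeta>. 1 - \<zeta>" and h = "\<lambda>_. - p"])
      fix \<zeta> assume \<zeta>: "\<zeta> \<in> S"
      define d where "d = 1 / w - \<zeta>"
      have *: "1 - w * \<zeta> = w * d" using w by (simp add: d_def field_simps)
      have "w * (deriv f \<zeta> * d * (1 - \<zeta>)) = w * (f \<zeta> * (d * - p - a * (1 - \<zeta>)))"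
        using ode[OF \<zeta>] unfolding * by (simp add: algebra_simps)
      then show "deriv f \<zeta> * (1 / w - \<zeta>) * (1 - \<zeta>) = f \<zeta> * ((1 / w - \<zeta>) * - p - a * (1 - \<zeta>))"
        unfolding d_def using w by (subst (asm) mult_left_cancel) auto
    qed (use w \<open>w \<noteq> 1\<close> wz in \<open>auto simp: S_def norm_divide field_simps\<close>)
  qed
qed

text \<open>The sum is the limit of the closed form along the segment from 0 to \<open>z\<close>.
  The first factor has a nonzero limit since \<open>z \<noteq> 1\<close>, so only the second can
  reach its branch point, namely if \<open>w * z = 1\<close>.\<close>

lemma binom_fps_prod_suminf:
  fixes p a w z :: complex
  assumes sm: "summable (\<lambda>n. fps_nth (binom_fps p 1 * binom_fps a w) n * z ^ n)"
    and pa: "p + a \<notin> \<nat>" and z: "z \<noteq> 1"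
  shows "(\<Sum>n. fps_nth (binom_fps p 1 * binom_fps a w) n * z ^ n) = cpow (1 - z) p * cpow (1 - w * z) a"
proof -
  define s where "s = (\<Sum>n. fps_nth (binom_fps p 1 * binom_fps a w) n * z ^ n)"
  define P where "P r = cpow (1 - of_real r * z) p" for r :: real
  define Q where "Q r = cpow (1 - of_real r * (w * z)) a" for r :: real
  note dich = binom_fps_prod_summable_imp[OF sm pa]
  have lim: "((\<lambda>r. P r * Q r) \<longlongrightarrow> s) (at_left 1)"
  proof (rule Lim_transform_eventually)
    show "((\<lambda>r. \<Sum>n. fps_nth (binom_fps p 1 * binom_fps a w) n * z ^ n * of_real r ^ n) \<longlongrightarrow> s) (at_left (1::real))"
      unfolding s_def by (rule Abel_limit[OF sm])
    \<comment> \<open>Scaling by \<open>r < 1\<close> turns the weak inequalities of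
      \<open>dich\<close> into the strict ones required for the binomial series.\<close>
    show "eventually (\<lambda>r. (\<Sum>n. fps_nth (binom_fps p 1 * binom_fps a w) n * z ^ n * of_real r ^ n)
        = P r * Q r) (at_left (1::real))"
    proof (rule eventually_at_leftI[of 0])
      fix r :: real assume r: "r \<in> {0<..<1}"
      have small: "norm (of_real r * y) < 1" if "norm y \<le> 1" for y :: complex
      proof -
        have "r * norm y \<le> r * 1" using r that by (intro mult_left_mono) auto
        moreover have "norm (of_real r * y) = r * norm y" using r by (simp add: norm_mult)
        ultimately show ?thesis using r unfolding greaterThanLessThan_iff by linarith
      qed
      have "norm (of_real r * z) < 1 \<or> p \<in> \<nat>" using dich(1) small by blast
      moreover have "norm (w * (of_real r * z)) < 1 \<or> a \<in> \<nat>"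
        using dich(2) small[of "w * z"] by (auto simp: mult.left_commute)
      ultimately have "(\<lambda>n. fps_nth (binom_fps p 1 * binom_fps a w) n * (of_real r * z) ^ n) sums (P r * Q r)"
        unfolding P_def Q_def by (subst mult.left_commute) (rule binom_fps_prod_sums)
      then show "(\<Sum>n. fps_nth (binom_fps p 1 * binom_fps a w) n * z ^ n * of_real r ^ n) = P r * Q r"
        by (simp add: sums_iff power_mult_distrib mult_ac)
    qed auto
  qed
  have limP: "(P \<longlongrightarrow> cpow (1 - z) p) (at_left 1)"
    unfolding P_def using z dich(1) by (rule tendsto_cpow_left)
  have nz: "cpow (1 - z) p \<noteq> 0" using z by (intro cpow_nonzero) auto
  \<comment> \<open>Division by the first factor shows that \<open>Q\<close> has a limit at all,
    which is what the case \<open>w * z = 1\<close> relies on.\<close>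
  have limQ: "(Q \<longlongrightarrow> s / cpow (1 - z) p) (at_left 1)"
  proof (rule Lim_transform_eventually)
    show "((\<lambda>r. P r * Q r / P r) \<longlongrightarrow> s / cpow (1 - z) p) (at_left 1)"
      by (intro tendsto_divide lim limP nz)
    show "eventually (\<lambda>r. P r * Q r / P r = Q r) (at_left 1)"
      using tendsto_imp_eventually_ne[OF limP nz] by eventually_elim simp
  qed
  have "s / cpow (1 - z) p = cpow (1 - w * z) a"
  proof (cases "w * z = 1")
    case True
    then show ?thesis
      using limQ cpow_one_minus_limit_unique[of a] unfolding Q_def by simp
  next
    case False
    then have "(Q \<longlongrightarrow> cpow (1 - w * z) a) (at_left 1)"
      unfolding Q_def using dich(2) by (rule tendsto_cpow_left)
    with limQ show ?thesis by (intro tendsto_unique[of "at_left (1::real)"]) auto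
  qed
  then show ?thesis using nz by (simp add: s_def field_simps)
qed

section \<open>The identity in the original variables\<close>

theorem proposition3p46:
  fixes a b m u x :: complex
  assumes "b + m + 1 \<notin> \<int>\<^sub>\<le>\<^sub>0" and "x \<noteq> - 1"
  shows "(norm (x / (x + 1)) < 1 \<and> (norm ((1 - u) * (x / (x + 1))) < 1 \<or> a \<in> \<nat>)
            \<longrightarrow> summable (summand a b m u x))
       \<and> (summable (summand a b m u x) \<and> branches_agree a u x
            \<longrightarrow> (\<Sum>n. summand a b m u x n) = cpow (u * x + 1) a * cpow (x + 1) (b + m + 1))"
proof -
  define c where "c = b + m + 1"
  define z where "z = x / (x + 1)"
  have "x + 1 \<noteq> 0" using assms(2) by (simp add: eq_neg_iff_add_eq_0)
  then have z1: "z \<noteq> 1" by (simp add: z_def)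
  have summand: "summand a b m u x
      = (\<lambda>n. fps_nth (binom_fps (- c - a) 1 * binom_fps a (1 - u)) n * z ^ n)"
    unfolding c_def z_def by (rule ext) (rule summand_eq_binom_fps_prod[OF assms])
  \<comment> \<open>With \<open>p = - c - a\<close> this becomes the condition that
    \<open>p + a\<close> is not natural.\<close>
  have "- c \<notin> \<nat>"
    unfolding uminus_in_Nats_iff using assms(1) by (simp add: c_def)
  then have c: "- c - a + a \<notin> \<nat>"
    by (simp only: diff_add_cancel) simp
  have "summable (summand a b m u x)" if "norm z < 1" "norm ((1 - u) * z) < 1 \<or> a \<in> \<nat>"
    unfolding summand using that by (intro sums_summable[OF binom_fps_prod_sums]) auto
  moreover have "(\<Sum>n. summand a b m u x n) = cpow (u * x + 1) a * cpow (x + 1) c"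
    if sm: "summable (summand a b m u x)" and br: "branches_agree a u x"
  proof -
    note sm = sm[unfolded summand]
    have "c \<noteq> 0" using assms(1) by (auto simp: c_def)
    have "(\<Sum>n. summand a b m u x n) = cpow (1 - z) (- c - a) * cpow (1 - (1 - u) * z) a"
      unfolding summand by (rule binom_fps_prod_suminf[OF sm c z1])
    also have "\<dots> = cpow (u * x + 1) a * cpow (x + 1) c"
      using cpow_mobius[OF assms(2) \<open>c \<noteq> 0\<close> _ _ br] binom_fps_prod_summable_imp[OF sm c]
      by (simp add: z_def)
    finally show ?thesis .
  qed
  ultimately show ?thesis by (auto simp: c_def z_def)
qed

end
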